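(* Let $n\ge 1$ and let $\mathcal{W}$ be a linear subspace of $\mathbb{C}^n$. Then there exists an $EP$ matrix $T$ of order $n$ (that is, $T\in\mathbb{C}^{n\times n}$) such that $\mathcal{R}(T)=\mathcal{W}$.
   Context: For a complex square matrix $T$, $\mathcal{R}(T)$ denotes its range (column space) and $T^*$ its conjugate transpose. A square complex matrix $T$ is called an $EP$ matrix if $\mathcal{R}(T)=\mathcal{R}(T^* )$. *)

theory Defs
  imports "HOL-Analysis.Analysis"
begin

definition conj_transpose :: "complex ^ 'n ^ 'm \<Rightarrow> complex ^ 'm ^ 'n" where
  "conj_transpose T = transpose (map_matrix cnj T)"

definition mat_range :: "complex ^ 'n ^ 'm \<Rightarrow> (complex ^ 'm) set" where
  "mat_range T = range (\<lambda>x. T *v x)"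

definition EP_matrix :: "complex ^ 'n ^ 'n \<Rightarrow> bool" where
  "EP_matrix T \<longleftrightarrow> mat_range T = mat_range (conj_transpose T)"

end

theory Submission
  imports Defs
begin

text \<open>
  The orthogonal projection onto \<open>W\<close> is given by a Hermitian matrix with range \<open>W\<close>, and a
  Hermitian matrix has the same range as its conjugate transpose.

  The type \<open>complex ^ 'n\<close> is a Euclidean space over the reals; its inner product is the real part
  of the Hermitian one. The projection onto \<open>W\<close> for this real inner product turns out to be the
  Hermitian projection: multiplication by a complex scalar \<open>c\<close> has as its real adjoint
  multiplication by \<open>cnj c\<close>, so the real orthogonal complement of a complex subspace is again
  complex, which makes the projection complex linear (\<open>orthogonal_projection_linear\<close>).
  Its real self-adjointness then identifies it with the action of the conjugate transpose of its
  matrix, as the conjugate transpose is also the adjoint for the real inner product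
  (\<open>inner_conj_transpose\<close>).
\<close>

lemma inner_vec_scalar_mult_left:
  fixes x y :: "complex ^ 'n"
  shows "inner (c *s x) y = inner x (cnj c *s y)"
  by (simp add: inner_vec_def inner_complex_def algebra_simps)

text \<open>On each coordinate the real inner product of \<open>a\<close> and \<open>b\<close> is \<open>Re (a * cnj b)\<close>, so the real
  identity is the real part of the usual one for the Hermitian product.\<close>

lemma inner_conj_transpose:
  fixes T :: "complex ^ 'n ^ 'm"
  shows "inner (T *v x) y = inner x (conj_transpose T *v y)"
proof -
  have "inner (T *v x) y = (\<Sum>i\<in>UNIV. \<Sum>j\<in>UNIV. inner (T $ i $ j * x $ j) (y $ i))"
    by (simp add: inner_vec_def matrix_vector_mult_def inner_sum_left)
  also have "\<dots> = (\<Sum>j\<in>UNIV. \<Sum>i\<in>UNIV. inner (x $ j) (cnj (T $ i $ j) * y $ i))"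
    by (subst sum.swap) (simp add: inner_complex_def algebra_simps)
  also have "\<dots> = inner x (conj_transpose T *v y)"
    by (simp add: inner_vec_def matrix_vector_mult_def inner_sum_right conj_transpose_def
        transpose_def map_matrix_def)
  finally show ?thesis .
qed

lemma vec_subspace_imp_subspace:
  fixes W :: "(complex ^ 'n) set"
  assumes "vec.subspace W"
  shows "subspace W"
proof -
  have "r *\<^sub>R x = complex_of_real r *s x" for r and x :: "complex ^ 'n"
    by (simp add: vec_eq_iff scaleR_conv_of_real[symmetric])
  then show ?thesis
    using assms unfolding subspace_def vec.subspace_def by simp
qed

lemma orthogonal_projection_unique:
  fixes W :: "'a::real_inner set"
  assumes "subspace W" "p \<in> W" "q \<in> W"
    and "\<And>w. w \<in> W \<Longrightarrow> inner (x - p) w = 0" "\<And>w. w \<in> W \<Longrightarrow> inner (x - q) w = 0"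
  shows "p = q"
proof -
  have "p - q \<in> W" using assms subspace_diff by blast
  then have "inner (x - q) (p - q) - inner (x - p) (p - q) = 0" using assms by simp
  then have "inner (p - q) (p - q) = 0" by (simp add: inner_diff_left)
  then show ?thesis by simp
qed

lemma orthogonal_projection_exists:
  fixes W :: "'a::euclidean_space set"
  assumes "subspace W"
  obtains P where "\<And>x. P x \<in> W" "\<And>x w. w \<in> W \<Longrightarrow> inner (x - P x) w = 0"
proof -
  have "\<exists>p. p \<in> W \<and> (\<forall>w\<in>W. inner (x - p) w = 0)" for x
  proof -
    obtain y z where "y \<in> span W" "\<And>w. w \<in> span W \<Longrightarrow> orthogonal z w" "x = y + z"
      using orthogonal_subspace_decomp_exists by blast
    then show ?thesis
      using assms by (intro exI[of _ y]) (simp add: span_eq_iff[THEN iffD2] orthogonal_def)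
  qed
  then show thesis using that by metis
qed

text \<open>By uniqueness, linearity only needs the images to lie in \<open>W\<close> and the residuals to be
  orthogonal to \<open>W\<close>. For a complex multiple of a residual, the scalar moves, conjugated, to the
  element of \<open>W\<close>; here \<open>W\<close> has to be closed under complex scalars.\<close>

lemma orthogonal_projection_linear:
  fixes W :: "(complex ^ 'n) set"
  assumes W: "vec.subspace W"
    and P: "\<And>x. P x \<in> W" "\<And>x w. w \<in> W \<Longrightarrow> inner (x - P x) w = 0"
  shows "Vector_Spaces.linear (*s) (*s) P"
proof -
  note unique = orthogonal_projection_unique[OF vec_subspace_imp_subspace[OF W]]
  have "P (x + y) = P x + P y" for x y
  proof (rule unique)
    show "inner (x + y - (P x + P y)) w = 0" if "w \<in> W" for w
      using P(2)[OF that, of x] P(2)[OF that, of y] by (simp add: inner_simps)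
  qed (use P W in \<open>auto intro: vec.subspace_add\<close>)
  moreover have "P (c *s x) = c *s P x" for c x
  proof (rule unique)
    fix w assume "w \<in> W"
    then have "cnj c *s w \<in> W" using W vec.subspace_scale by blast
    then have "inner (c *s (x - P x)) w = 0"
      unfolding inner_vec_scalar_mult_left by (rule P(2))
    then show "inner (c *s x - c *s P x) w = 0"
      by (simp add: vec.scale_right_diff_distrib)
  qed (use P W in \<open>auto intro: vec.subspace_scale\<close>)
  ultimately show ?thesis
    by (intro Vector_Spaces.linear.intro vec.vector_space_axioms)
       (auto simp: module_hom_def module_hom_axioms_def intro: vec.module_axioms)
qed

theorem theorem2p3:
  fixes W :: "(complex ^ 'n) set"
  assumes "vec.subspace W"
  shows "\<exists>T :: complex ^ 'n ^ 'n. EP_matrix T \<and> mat_range T = W"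
proof -
  have W: "subspace W" using assms by (rule vec_subspace_imp_subspace)
  obtain P where P: "\<And>x. P x \<in> W" "\<And>x w. w \<in> W \<Longrightarrow> inner (x - P x) w = 0"
    using orthogonal_projection_exists[OF W] by blast
  have T: "matrix P *v x = P x" for x
    using orthogonal_projection_linear[OF assms P] by (rule matrix_works)
  have "P w = w" if "w \<in> W" for w
    using orthogonal_projection_unique[OF W P(1) that P(2), of w] by simp
  then have range: "mat_range (matrix P) = W"
    unfolding mat_range_def T using P(1) by (metis image_subset_iff rangeI subset_antisym subsetI)
  have selfadjoint: "inner (P x) y = inner x (P y)" for x y
  proof -
    have "inner (P x) y = inner (P x) (P y)"
      using P(2)[OF P(1)[of x], of y] by (simp add: inner_diff_left inner_commute[of "P x"])
    also have "\<dots> = inner x (P y)"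
      using P(2)[OF P(1)[of y], of x] by (simp add: inner_diff_left)
    finally show ?thesis .
  qed
  have "conj_transpose (matrix P) *v y = matrix P *v y" for y
  proof -
    have "inner x (conj_transpose (matrix P) *v y) = inner x (P y)" for x
      by (simp add: inner_conj_transpose[symmetric] T selfadjoint)
    then show ?thesis unfolding T using vector_eq_rdot by (metis inner_commute)
  qed
  then have "EP_matrix (matrix P)"
    by (simp add: EP_matrix_def mat_range_def)
  with range show ?thesis by blast
qed

end
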